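(* Let $\mu$ be a continuous, computable measure on $2^\omega$. Then there is a computable order $h$ such that $|h(n)-g_\mu^{-1}(n)|\le O(1)$ (i.e. the difference is bounded by a constant independent of $n$), and such that for every $\mu$-Martin-Löf random $X\in 2^\omega$ we have $\mathrm K(X\upharpoonright n)\ge h(n)$ for every $n$.
   Context: All measures are Borel probability measures on Cantor space $2^\omega$; for a finite binary string $\sigma$ write $\mu(\sigma)=\mu(\{X:\sigma\prec X\})$. A measure $\mu$ is computable if $\sigma\mapsto\mu(\sigma)$ is computable as a real-valued function, and continuous if $\mu(\{X\})=0$ for all $X\in 2^\omega$. For a continuous measure $\mu$, the granularity function $g_\mu:\omega\to\omega$ maps $n$ to the least $\ell$ such that $\mu(\sigma)<2^{-n}$ for every string $\sigma$ of length $\ell$; it is non-decreasing and unbounded. For a non-decreasing unbounded $g:\omega\to\omega$, $g^{-1}(n)=\min\{k: g(k)\ge n\}$. An order is a non-decreasing unbounded function $f:\omega\to\omega$, required to satisfy $f(0)=0$ (this normalization is not imposed on $g_\mu$). A $\mu$-Martin-Löf test is a sequence $(\mathcal U_i)_{i\in\omega}$ of uniformly $\Sigma^0_1$ classes with $\mu(\mathcal U_i)\le 2^{-i}$ for every $i$; $X$ is $\mu$-Martin-Löf random if $X\notin\bigcap_i\mathcal U_i$ for every such test. $\mathrm K$ is prefix-free Kolmogorov complexity and $X\upharpoonright n$ is the initial segment of $X$ of length $n$.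
   Formalization: The bound K(X↾n) ≥ h(n) is proved as K(X↾n) ≥ h(n) − d for all n, with d depending on X; without such a constant the claim fails, e.g. for the uniform measure and the randoms 0^m R, since K(0^m) = O(log m). *)

theory Defs
  imports "HOL-Probability.Probability" "HOL-Library.Sublist"
begin

(* Partial recursive functions.  Programs are evaluated on argument lists of any length, so no
   arities are tracked; a program is undefined on argument lists that do not fit its shape.
   Prec recurses on the first argument, and its step function g receives (recursive value,
   counter, parameters). *)

datatype recf = Zero | Succ | Proj nat | Comp recf "recf list" | Prec recf recf | Mu recf

inductive computes :: "recf \<Rightarrow> nat list \<Rightarrow> nat \<Rightarrow> bool" where
  Zero: "computes Zero xs 0"
| Succ: "computes Succ [x] (Suc x)"
| Proj: "i < length xs \<Longrightarrow> computes (Proj i) xs (xs ! i)"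
| Comp: "list_all2 (\<lambda>g y. computes g xs y) gs ys \<Longrightarrow> computes f ys z \<Longrightarrow>
           computes (Comp f gs) xs z"
| Prec_0: "computes f xs y \<Longrightarrow> computes (Prec f g) (0 # xs) y"
| Prec_Suc: "computes (Prec f g) (n # xs) y \<Longrightarrow> computes g (y # n # xs) z \<Longrightarrow>
           computes (Prec f g) (Suc n # xs) z"
| Mu: "computes f (n # xs) 0 \<Longrightarrow> (\<And>m. m < n \<Longrightarrow> \<exists>y. computes f (m # xs) (Suc y)) \<Longrightarrow>
           computes (Mu f) xs n"

definition computable :: "(nat \<Rightarrow> nat) \<Rightarrow> bool" where
  "computable f \<longleftrightarrow> (\<exists>r. \<forall>n. computes r [n] (f n))"

definition computable2 :: "(nat \<Rightarrow> nat \<Rightarrow> nat) \<Rightarrow> bool" where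
  "computable2 f \<longleftrightarrow> (\<exists>r. \<forall>m n. computes r [m, n] (f m n))"

(* The dyadic numbering, a bijection between finite binary strings and natural numbers. *)
fun str_code :: "bool list \<Rightarrow> nat" where
  "str_code [] = 0"
| "str_code (b # \<sigma>) = 2 * str_code \<sigma> + (if b then 2 else 1)"

(* A computable double sequence of rationals is given as (a - b) / (c + 1) with a, b, c computable. *)
definition computable_real_fun :: "(bool list \<Rightarrow> real) \<Rightarrow> bool" where
  "computable_real_fun f \<longleftrightarrow>
     (\<exists>a b c. computable2 a \<and> computable2 b \<and> computable2 c \<and>
        (\<forall>\<sigma> k. \<bar>f \<sigma> - (real (a (str_code \<sigma>) k) - real (b (str_code \<sigma>) k)) /
                     (real (c (str_code \<sigma>) k) + 1)\<bar> \<le> 1 / 2 ^ k))"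


type_synonym cantor = "nat \<Rightarrow> bool"

definition initseg :: "cantor \<Rightarrow> nat \<Rightarrow> bool list" where
  "initseg X n = map X [0..<n]"

definition cylinder :: "bool list \<Rightarrow> cantor set" where
  "cylinder \<sigma> = {X. initseg X (length \<sigma>) = \<sigma>}"

(* borel refers to the product topology on functions nat => bool, with bool discrete. *)
definition cantor_measure :: "cantor measure \<Rightarrow> bool" where
  "cantor_measure \<mu> \<longleftrightarrow> prob_space \<mu> \<and> sets \<mu> = sets borel"

definition computable_measure :: "cantor measure \<Rightarrow> bool" where
  "computable_measure \<mu> \<longleftrightarrow> computable_real_fun (\<lambda>\<sigma>. measure \<mu> (cylinder \<sigma>))"

definition continuous_measure :: "cantor measure \<Rightarrow> bool" where
  "continuous_measure \<mu> \<longleftrightarrow> (\<forall>X. measure \<mu> {X} = 0)"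

definition granularity :: "cantor measure \<Rightarrow> nat \<Rightarrow> nat" where
  "granularity \<mu> n = (LEAST l. \<forall>\<sigma>. length \<sigma> = l \<longrightarrow> measure \<mu> (cylinder \<sigma>) < 1 / 2 ^ n)"

definition order_inverse :: "(nat \<Rightarrow> nat) \<Rightarrow> nat \<Rightarrow> nat" where
  "order_inverse g n = (LEAST k. n \<le> g k)"

definition is_order :: "(nat \<Rightarrow> nat) \<Rightarrow> bool" where
  "is_order f \<longleftrightarrow> mono f \<and> (\<forall>b. \<exists>n. b \<le> f n) \<and> f 0 = 0"


definition uniformly_Sigma1 :: "(nat \<Rightarrow> cantor set) \<Rightarrow> bool" where
  "uniformly_Sigma1 \<U> \<longleftrightarrow>
     (\<exists>r. \<forall>i. \<U> i = \<Union> {cylinder \<sigma> | \<sigma>. \<exists>y. computes r [i, str_code \<sigma>] y})"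

definition martin_loef_test :: "cantor measure \<Rightarrow> (nat \<Rightarrow> cantor set) \<Rightarrow> bool" where
  "martin_loef_test \<mu> \<U> \<longleftrightarrow> uniformly_Sigma1 \<U> \<and> (\<forall>i. measure \<mu> (\<U> i) \<le> 1 / 2 ^ i)"

definition martin_loef_random :: "cantor measure \<Rightarrow> cantor \<Rightarrow> bool" where
  "martin_loef_random \<mu> X \<longleftrightarrow> (\<forall>\<U>. martin_loef_test \<mu> \<U> \<longrightarrow> X \<notin> (\<Inter>i. \<U> i))"


definition partial_computable_str :: "(bool list \<Rightarrow> bool list option) \<Rightarrow> bool" where
  "partial_computable_str M \<longleftrightarrow>
     (\<exists>r. \<forall>p n. computes r [str_code p] n \<longleftrightarrow> (\<exists>\<sigma>. M p = Some \<sigma> \<and> n = str_code \<sigma>))"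

definition prefix_free_machine :: "(bool list \<Rightarrow> bool list option) \<Rightarrow> bool" where
  "prefix_free_machine M \<longleftrightarrow> partial_computable_str M \<and>
     (\<forall>p \<in> dom M. \<forall>q \<in> dom M. prefix p q \<longrightarrow> p = q)"

(* Every machine that is universal by adjunction is universal in this sense. *)
definition universal_prefix_free_machine :: "(bool list \<Rightarrow> bool list option) \<Rightarrow> bool" where
  "universal_prefix_free_machine U \<longleftrightarrow> prefix_free_machine U \<and>
     (\<forall>M. prefix_free_machine M \<longrightarrow>
        (\<exists>c. \<forall>p \<sigma>. M p = Some \<sigma> \<longrightarrow> (\<exists>q. U q = Some \<sigma> \<and> length q \<le> length p + c)))"

(* Prefix-free Kolmogorov complexity relative to U.  For universal U every string has a
   description, so the minimum is always attained.  Inequalities for K are meant up to an additive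
   constant.  For a lower bound along a random sequence X that constant has to depend on X: if R is
   random for the uniform measure then so is 0^m R for every m, and its initial segment of length m
   has complexity O(log m). *)
definition K :: "(bool list \<Rightarrow> bool list option) \<Rightarrow> bool list \<Rightarrow> nat" where
  "K U \<sigma> = (LEAST n. \<exists>p. U p = Some \<sigma> \<and> length p = n)"

end

theory Submission
  imports Defs
begin

text \<open>Why the theorem holds. Let \<open>m n\<close> be the largest measure of a cylinder \<open>cylinder \<sigma>\<close> with
  \<open>length \<sigma> = n\<close>. By definition of the granularity, the inverse granularity of \<open>n + 1\<close> is the least
  \<open>k\<close> with \<open>1 / 2 ^ k \<le> m n\<close>, that is, \<open>- log 2 (m n)\<close> rounded up
  (\<open>order_inverse_granularity_Suc\<close>). Compactness of Cantor space enters here: for a continuous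
  measure \<open>m n\<close> tends to 0 (\<open>cylinders_uniformly_small\<close>, by Koenig's lemma), so the granularity
  exists and its inverse is unbounded.

  Whether \<open>1 / 2 ^ k \<le> m n\<close> holds cannot be decided from approximations of the measure, but the
  question may be answered with an error of a factor 2. Searching for the least \<open>k\<close> that passes
  this approximate test gives a computable function within distance 1 of the inverse granularity
  (\<open>log_estimate_close\<close>). Its running maximum \<open>h\<close> is monotone, starts at 0 and stays within
  distance 1, because the inverse granularity is itself monotone (\<open>running_max_close\<close>).

  The complexity bound is the easy half of the Levin-Schnorr theorem, with a computable bound
  \<open>1 / 2 ^ f n\<close>, where \<open>f n = h n - 2\<close>, in the place of the measure of a string of length \<open>n\<close>
  (\<open>random_complexity_lower_bound\<close>). Collect in \<open>complexity_test U f i\<close> the cylinders of all strings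
  \<open>\<sigma>\<close> with a description \<open>p\<close> such that \<open>length p + i \<le> f (length \<sigma>)\<close>. Each has measure at most
  \<open>1 / 2 ^ i\<close> times the weight \<open>1 / 2 ^ length p\<close> of this description, and Kraft's inequality bounds
  the total weight of all descriptions by 1. A random sequence avoids some level \<open>i\<close> of this test,
  which says that its initial segments of length \<open>n\<close> have complexity greater than \<open>f n - i\<close>.

  To enumerate the test one would usually run the machine \<open>U\<close> on all inputs in parallel. Since only
  the union of the cylinders matters, this can be avoided: a cylinder is the union of the cylinders
  of all extensions of a given greater length, so the length of the extension may serve to name the
  one input on which \<open>U\<close> is run (\<open>uniformly_Sigma1_complexity_test\<close>).\<close>

section \<open>Total recursive functions of a fixed arity\<close>

text \<open>Evaluation is deterministic, so that a program known to compute a total function has no other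
  values; every argument below that reads off a result from a halting computation uses this.\<close>

lemma computes_unique:
  assumes "computes r xs y" "computes r xs z"
  shows "y = z"
  using assms
proof (induction arbitrary: z rule: computes.induct)
  case (Zero xs)
  then show ?case by (auto elim: computes.cases)
next
  case (Succ x)
  then show ?case by (auto elim: computes.cases)
next
  case (Proj i xs)
  then show ?case by (auto elim: computes.cases)
next
  case (Comp xs gs ys f z)
  from Comp.prems obtain ys' where ys': "list_all2 (\<lambda>g y. computes g xs y) gs ys'" "computes f ys' z"
    by (cases rule: computes.cases) auto
  then have "ys = ys'"
    using Comp.IH(1) by (simp add: list_all2_conv_all_nth list_eq_iff_nth_eq)
  then show ?case using Comp.IH ys' by simp
next
  case (Prec_0 f xs y g)
  from Prec_0.prems show ?case by (cases rule: computes.cases) (auto intro: Prec_0.IH)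
next
  case (Prec_Suc f g n xs y z)
  from Prec_Suc.prems show ?case by (cases rule: computes.cases) (auto dest!: Prec_Suc.IH)
next
  case (Mu f n xs)
  from Mu.prems have z: "computes f (z # xs) 0" "\<And>m. m < z \<Longrightarrow> \<exists>y. computes f (m # xs) (Suc y)"
    by (auto elim: computes.cases)
  show ?case
    by (metis Mu.IH z linorder_neqE_nat nat.distinct(1))
qed

lemma computes_iff_eq: "computes r xs y \<Longrightarrow> computes r xs z \<longleftrightarrow> z = y"
  using computes_unique by blast

lemma computes_Comp_iff:
  "computes (Comp f gs) xs z \<longleftrightarrow> (\<exists>ys. list_all2 (\<lambda>g y. computes g xs y) gs ys \<and> computes f ys z)"
  by (auto intro: computes.Comp elim: computes.cases)

text \<open>All functions of \<open>k\<close> arguments are presented as functions of one argument list, so that the closure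
  properties compose without tuples of varying length; values on lists of other lengths are
  arbitrary.\<close>

definition recursive :: "nat \<Rightarrow> (nat list \<Rightarrow> nat) \<Rightarrow> bool" where
  "recursive k f \<longleftrightarrow> (\<exists>r. \<forall>xs. length xs = k \<longrightarrow> computes r xs (f xs))"

lemma recursive_cong:
  "(\<And>xs. length xs = k \<Longrightarrow> f xs = g xs) \<Longrightarrow> recursive k f \<longleftrightarrow> recursive k g"
  by (simp add: recursive_def)

lemma recursive_compose:
  assumes "recursive (length gs) f" "\<forall>g\<in>set gs. recursive k g"
  shows "recursive k (\<lambda>xs. f (map (\<lambda>g. g xs) gs))"
proof -
  obtain r where r: "\<And>ys. length ys = length gs \<Longrightarrow> computes r ys (f ys)"
    using assms(1) by (auto simp: recursive_def)
  obtain s where s: "\<And>g xs. g \<in> set gs \<Longrightarrow> length xs = k \<Longrightarrow> computes (s g) xs (g xs)"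
    using assms(2) unfolding recursive_def by metis
  have "computes (Comp r (map s gs)) xs (f (map (\<lambda>g. g xs) gs))" if "length xs = k" for xs
    by (rule computes.Comp[of _ _ "map (\<lambda>g. g xs) gs"])
      (use that in \<open>auto intro!: r s simp: list_all2_conv_all_nth\<close>)
  then show ?thesis unfolding recursive_def by blast
qed

lemma recursive_compose1:
  assumes "recursive 1 (\<lambda>xs. f (xs ! 0))" "recursive k a"
  shows "recursive k (\<lambda>xs. f (a xs))"
  using recursive_compose[of "[a]" "\<lambda>xs. f (xs ! 0)" k] assms by simp

lemma recursive_compose2:
  assumes "recursive 2 (\<lambda>xs. f (xs ! 0) (xs ! 1))" "recursive k a" "recursive k b"
  shows "recursive k (\<lambda>xs. f (a xs) (b xs))"
  using recursive_compose[of "[a, b]" "\<lambda>xs. f (xs ! 0) (xs ! 1)" k] assms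
  by (simp add: numeral_2_eq_2)

lemma computable_iff_recursive: "computable f \<longleftrightarrow> recursive 1 (\<lambda>xs. f (xs ! 0))"
proof -
  have "(\<forall>n. computes r [n] (f n)) \<longleftrightarrow> (\<forall>xs. length xs = 1 \<longrightarrow> computes r xs (f (xs ! 0)))" for r
    by (auto simp: length_Suc_conv)
  then show ?thesis by (simp only: computable_def recursive_def)
qed

lemma computable2_iff_recursive: "computable2 f \<longleftrightarrow> recursive 2 (\<lambda>xs. f (xs ! 0) (xs ! 1))"
proof -
  have "(\<forall>m n. computes r [m, n] (f m n)) \<longleftrightarrow>
    (\<forall>xs. length xs = 2 \<longrightarrow> computes r xs (f (xs ! 0) (xs ! 1)))" for r
    by (force simp: length_Suc_conv numeral_2_eq_2)
  then show ?thesis by (simp only: computable2_def recursive_def)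
qed

lemma recursive_computable:
  "computable f \<Longrightarrow> recursive k a \<Longrightarrow> recursive k (\<lambda>xs. f (a xs))"
  by (simp add: computable_iff_recursive recursive_compose1)

lemma recursive_computable2:
  "computable2 f \<Longrightarrow> recursive k a \<Longrightarrow> recursive k b \<Longrightarrow> recursive k (\<lambda>xs. f (a xs) (b xs))"
  unfolding computable2_iff_recursive by (rule recursive_compose2)

lemma recursive_nth: "i < k \<Longrightarrow> recursive k (\<lambda>xs. xs ! i)"
  unfolding recursive_def by (metis computes.Proj)

lemma recursive_Suc: "recursive k f \<Longrightarrow> recursive k (\<lambda>xs. Suc (f xs))"
proof (rule recursive_compose1[of Suc])
  show "recursive 1 (\<lambda>xs. Suc (xs ! 0))"
    unfolding recursive_def by (rule exI[of _ Succ]) (auto simp: length_Suc_conv intro: computes.Succ)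
qed

lemma recursive_const: "recursive k (\<lambda>_. c)"
proof (induction c)
  case 0
  show ?case unfolding recursive_def using computes.Zero by blast
qed (rule recursive_Suc)

lemma recursive_rec_nat:
  assumes "recursive k f" "recursive (Suc (Suc k)) g"
  shows "recursive (Suc k) (\<lambda>xs. rec_nat (f (tl xs)) (\<lambda>n y. g (y # n # tl xs)) (hd xs))"
proof -
  obtain r where r: "\<And>ys. length ys = k \<Longrightarrow> computes r ys (f ys)"
    using assms(1) by (auto simp: recursive_def)
  obtain s where s: "\<And>ys. length ys = Suc (Suc k) \<Longrightarrow> computes s ys (g ys)"
    using assms(2) by (auto simp: recursive_def)
  have "computes (Prec r s) (n # xs) (rec_nat (f xs) (\<lambda>n y. g (y # n # xs)) n)"
    if "length xs = k" for n xs
    by (induction n) (use that in \<open>auto intro!: computes.intros r s\<close>)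
  then show ?thesis
    unfolding recursive_def by (intro exI[of _ "Prec r s"]) (auto simp: length_Suc_conv)
qed

text \<open>Unbounded search makes the step from decidable to semidecidable conditions: the program halts
  iff some \<open>n\<close> satisfies \<open>f (n # xs) = 0\<close>. Searches that always succeed give \<open>recursive_Least\<close>;
  searches that may fail enumerate the test.\<close>

lemma semidecidable_search:
  assumes "recursive (Suc k) f"
  shows "\<exists>r. \<forall>xs. length xs = k \<longrightarrow> (\<forall>n. computes r xs n \<longrightarrow> f (n # xs) = 0) \<and>
    ((\<exists>n. f (n # xs) = 0) \<longrightarrow> computes r xs (LEAST n. f (n # xs) = 0))"
proof -
  obtain r where r: "\<And>ys. length ys = Suc k \<Longrightarrow> computes r ys (f ys)"
    using assms by (auto simp: recursive_def)
  have "f (n # xs) = 0" if "length xs = k" "computes (Mu r) xs n" for xs n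
  proof -
    from that(2) have "computes r (n # xs) 0" by (cases rule: computes.cases) auto
    then show ?thesis using r[of "n # xs"] that(1) computes_unique by auto
  qed
  moreover have "computes (Mu r) xs (LEAST n. f (n # xs) = 0)"
    if "length xs = k" "f (n # xs) = 0" for xs n
  proof (rule computes.Mu)
    have "f ((LEAST n. f (n # xs) = 0) # xs) = 0"
      by (rule LeastI[of "\<lambda>n. f (n # xs) = 0"]) (rule that)
    then show "computes r ((LEAST n. f (n # xs) = 0) # xs) 0"
      using r[of "(LEAST n. f (n # xs) = 0) # xs"] that by simp
  next
    fix m assume "m < (LEAST n. f (n # xs) = 0)"
    then have "f (m # xs) \<noteq> 0" by (rule not_less_Least)
    then show "\<exists>y. computes r (m # xs) (Suc y)"
      using r[of "m # xs"] that by (metis length_Cons not0_implies_Suc)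
  qed
  ultimately show ?thesis by (intro exI[of _ "Mu r"]) blast
qed

lemma recursive_Least:
  assumes "recursive (Suc k) (\<lambda>ys. f (hd ys) (tl ys))" "\<And>xs. length xs = k \<Longrightarrow> \<exists>n. f n xs = 0"
  shows "recursive k (\<lambda>xs. LEAST n. f n xs = 0)"
proof -
  from semidecidable_search[OF assms(1)] obtain r where "\<And>xs. length xs = k \<Longrightarrow> (\<exists>n. f n xs = 0) \<Longrightarrow>
    computes r xs (LEAST n. f n xs = 0)" by auto
  then show ?thesis unfolding recursive_def using assms(2) by blast
qed

lemma recursive_hd: "recursive (Suc k) hd"
  unfolding recursive_def
proof (intro exI[of _ "recf.Proj 0"] allI impI)
  fix xs :: "nat list" assume "length xs = Suc k"
  then show "computes (recf.Proj 0) xs (hd xs)"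
    using computes.Proj[of 0 xs] by (cases xs) auto
qed

text \<open>The operators for minimisation and summation put the bound variable in front of the argument list;
  this lemma and its corollaries lift functions of the outer arguments past it.\<close>

lemma recursive_tl:
  assumes "recursive k f"
  shows "recursive (Suc k) (\<lambda>ys. f (tl ys))"
proof -
  let ?gs = "map (\<lambda>i ys. ys ! Suc i) [0..<k]"
  have args: "map (\<lambda>g. g ys) ?gs = tl ys" if "length ys = Suc k" for ys :: "nat list"
    using that by (auto simp: list_eq_iff_nth_eq nth_tl)
  have "recursive (Suc k) (\<lambda>ys. f (map (\<lambda>g. g ys) ?gs))"
    by (rule recursive_compose) (use assms in \<open>auto intro: recursive_nth\<close>)
  then show ?thesis
    by (rule recursive_cong[THEN iffD1, rotated]) (simp only: args)
qed

lemma recursive_nth_tl: "i < k \<Longrightarrow> recursive (Suc k) (\<lambda>ys. tl ys ! i)"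
  by (intro recursive_tl recursive_nth)

lemma recursive_nth_tl_tl: "i < k \<Longrightarrow> recursive (Suc (Suc k)) (\<lambda>ys. tl (tl ys) ! i)"
  by (intro recursive_tl[of _ "\<lambda>ys. tl ys ! i"] recursive_nth_tl)

lemma recursive_hd_tl: "recursive (Suc (Suc k)) (\<lambda>ys. hd (tl ys))"
  by (intro recursive_tl recursive_hd)

lemmas recursive_args = recursive_const recursive_nth recursive_hd recursive_nth_tl recursive_nth_tl_tl
  recursive_hd_tl recursive_Suc

text \<open>Recognising a function by its recursion equation, instead of as an instance of \<open>rec_nat\<close>, lets the
  usual equations of the arithmetic operations be used directly.\<close>

lemma recursive_primrec2:
  assumes "recursive 1 (\<lambda>xs. f 0 (xs ! 0))"
    and "recursive 3 (\<lambda>ys. g (ys ! 0) (ys ! 1) (ys ! 2))"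
    and "\<And>n x. f (Suc n) x = g (f n x) n x"
  shows "recursive 2 (\<lambda>xs. f (xs ! 0) (xs ! 1))"
proof -
  have "rec_nat (f 0 x) (\<lambda>n y. g y n x) n = f n x" for n x
    by (induction n) (simp_all add: assms(3))
  then have "recursive 2 (\<lambda>xs. f (hd xs) (tl xs ! 0))"
    using recursive_rec_nat[of 1 "\<lambda>xs. f 0 (xs ! 0)" "\<lambda>ys. g (ys ! 0) (ys ! 1) (ys ! 2)"] assms(1,2)
    by (simp add: numeral_2_eq_2 numeral_3_eq_3)
  moreover have "f (hd xs) (tl xs ! 0) = f (xs ! 0) (xs ! 1)" if "length xs = 2" for xs
    using that by (cases xs) auto
  ultimately show ?thesis by (simp cong: recursive_cong)
qed

lemma recursive_add: "recursive k a \<Longrightarrow> recursive k b \<Longrightarrow> recursive k (\<lambda>xs. a xs + b xs)"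
  by (rule recursive_compose2[of "(+)"], rule recursive_primrec2[of "(+)" "\<lambda>y n x. Suc y"])
    (simp_all add: recursive_Suc recursive_nth)

lemma recursive_mult: "recursive k a \<Longrightarrow> recursive k b \<Longrightarrow> recursive k (\<lambda>xs. a xs * b xs)"
  by (rule recursive_compose2[of "(*)"], rule recursive_primrec2[of "(*)" "\<lambda>y n x. x + y"])
    (simp_all add: recursive_const recursive_add recursive_nth)

lemma recursive_primrec1:
  assumes "recursive 2 (\<lambda>ys. g (ys ! 0) (ys ! 1))"
    and "\<And>n. f (Suc n) = g (f n) n"
  shows "recursive 1 (\<lambda>xs. f (xs ! 0))"
proof -
  have "recursive 3 (\<lambda>ys. g (ys ! 0) (ys ! 1))"
    by (rule recursive_compose2[OF assms(1)]) (simp_all add: recursive_nth)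
  then have "recursive 2 (\<lambda>xs. f (xs ! 0))"
    by (intro recursive_primrec2[of "\<lambda>n x. f n" "\<lambda>y n x. g y n"])
      (simp_all add: assms(2) recursive_const)
  then show ?thesis
    by (rule recursive_compose2[of "\<lambda>n x. f n" _ _ "\<lambda>xs. xs ! 0"]) (simp_all add: recursive_nth)
qed

lemma recursive_power:
  assumes "recursive k a"
  shows "recursive k (\<lambda>xs. c ^ a xs)"
proof (rule recursive_compose1[OF _ assms])
  show "recursive 1 (\<lambda>xs. c ^ (xs ! 0))"
    by (rule recursive_primrec1[of "\<lambda>y n. c * y" "power c"])
      (simp_all add: recursive_const recursive_mult recursive_nth)
qed

lemma recursive_diff:
  assumes "recursive k a" "recursive k b"
  shows "recursive k (\<lambda>xs. a xs - b xs)"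
proof -
  have pred: "recursive 1 (\<lambda>xs. xs ! 0 - 1)"
    by (rule recursive_primrec1[of "\<lambda>y n. n" "\<lambda>n. n - 1"]) (simp_all add: recursive_nth)
  \<comment> \<open>Primitive recursion runs on the first argument, which here is the subtrahend.\<close>
  have "recursive 3 (\<lambda>xs. xs ! 0 - 1)"
    by (rule recursive_compose1[OF pred]) (simp add: recursive_nth)
  then have "recursive 2 (\<lambda>xs. xs ! 1 - xs ! 0)"
    by (intro recursive_primrec2[of "\<lambda>n x. x - n" "\<lambda>y n x. y - 1"])
      (simp_all add: recursive_nth)
  then show ?thesis by (rule recursive_compose2[of "\<lambda>x y. y - x"]) (use assms in simp_all)
qed

lemma recursive_sum:
  assumes "recursive (Suc k) (\<lambda>ys. f (hd ys) (tl ys))" "recursive k b"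
  shows "recursive k (\<lambda>xs. \<Sum>v<b xs. f v xs)"
proof -
  have "recursive (Suc (Suc k)) (\<lambda>ys. hd ys + f (hd (tl ys)) (tl (tl ys)))"
    by (intro recursive_add recursive_hd recursive_tl[OF assms(1)])
  from recursive_rec_nat[OF recursive_const[of k 0] this]
  have "recursive (Suc k) (\<lambda>xs. rec_nat 0 (\<lambda>n y. y + f n (tl xs)) (hd xs))" by simp
  moreover have "rec_nat 0 (\<lambda>n y. y + f n xs) m = (\<Sum>v<m. f v xs)" for m xs
    by (induction m) auto
  ultimately have S: "recursive (Suc k) (\<lambda>xs. \<Sum>v<hd xs. f v (tl xs))" by simp
  let ?gs = "b # map (\<lambda>i xs. xs ! i) [0..<k]"
  have args: "map (\<lambda>g. g xs) ?gs = b xs # xs" if "length xs = k" for xs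
    using that map_nth[of xs] by (simp add: comp_def)
  have "recursive k (\<lambda>xs. (\<lambda>xs. \<Sum>v<hd xs. f v (tl xs)) (map (\<lambda>g. g xs) ?gs))"
    by (rule recursive_compose) (use S assms(2) in \<open>simp_all add: recursive_nth\<close>)
  then show ?thesis
    by (rule recursive_cong[THEN iffD1, rotated]) (simp only: args list.sel)
qed

lemmas recursive_intros = recursive_args recursive_add recursive_mult recursive_power recursive_diff

section \<open>The numbering of binary strings\<close>

text \<open>The numbering is bijective base-2 notation with the least significant digit first, hence
  concatenation is addition after a shift. This makes the prefix relation arithmetical
  (\<open>prefix_iff_str_code\<close> below).\<close>

lemma str_code_append: "str_code (\<sigma> @ \<rho>) = str_code \<sigma> + 2 ^ length \<sigma> * str_code \<rho>"
  by (induction \<sigma>) auto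

lemma str_code_bounds: "2 ^ length \<sigma> \<le> Suc (str_code \<sigma>)" "Suc (str_code \<sigma>) < 2 ^ Suc (length \<sigma>)"
  by (induction \<sigma>) auto

lemma inj_str_code: "inj str_code"
proof (rule injI)
  fix \<sigma> \<tau> show "str_code \<sigma> = str_code \<tau> \<Longrightarrow> \<sigma> = \<tau>"
  proof (induction \<sigma> arbitrary: \<tau>)
    case Nil
    then show ?case by (cases \<tau>) (auto split: if_splits)
  next
    case (Cons b \<sigma>)
    then obtain b' \<tau>' where [simp]: "\<tau> = b' # \<tau>'" by (cases \<tau>) (auto split: if_splits)
    from Cons.prems have "b = b' \<and> str_code \<sigma> = str_code \<tau>'"
      by (auto split: if_splits) presburger+
    then show ?case using Cons.IH by simp
  qed
qed

lemma surj_str_code: "\<exists>\<sigma>. str_code \<sigma> = n"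
proof (induction n rule: less_induct)
  case (less n)
  show ?case
  proof (cases "n = 0")
    case True
    then show ?thesis by (intro exI[of _ "[]"]) simp
  next
    case False
    then obtain \<sigma> where \<sigma>: "str_code \<sigma> = (n - 1) div 2"
      using less[of "(n - 1) div 2"] by fastforce
    \<comment> \<open>The last digit is 2, written \<open>True\<close>, iff the positive number \<open>n\<close> is even.\<close>
    have "str_code (even n # \<sigma>) = n" using \<sigma> False by (auto; presburger)
    then show ?thesis by blast
  qed
qed

text \<open>The number \<open>x\<close> is the code of the rest of \<open>\<tau>\<close>: every number is the code of some string, and codes
  determine strings. Thus prefixes are recognised by an unbounded search for \<open>x\<close>.\<close>

lemma prefix_iff_str_code:
  "prefix \<sigma> \<tau> \<longleftrightarrow> (\<exists>x. str_code \<tau> = str_code \<sigma> + 2 ^ length \<sigma> * x)"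
proof
  assume "\<exists>x. str_code \<tau> = str_code \<sigma> + 2 ^ length \<sigma> * x"
  then obtain \<rho> where "str_code \<tau> = str_code (\<sigma> @ \<rho>)"
    using surj_str_code by (metis str_code_append)
  then show "prefix \<sigma> \<tau>" by (auto dest: injD[OF inj_str_code])
qed (auto simp: prefix_def str_code_append)

text \<open>Truncated subtraction turns \<open>s + 1 < 2 ^ (j + 1)\<close> into an equation with 0, the form that
  \<open>recursive_Least\<close> minimises. By \<open>str_code_bounds\<close> the result is the length of the string with
  code \<open>s\<close>.\<close>

definition code_length :: "nat \<Rightarrow> nat" where
  "code_length s = (LEAST j. s + 2 - 2 ^ Suc j = 0)"

lemma code_length_eqI:
  assumes "2 ^ j \<le> Suc s" "Suc s < 2 ^ Suc j"
  shows "code_length s = j"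
  unfolding code_length_def
proof (rule Least_equality)
  show "s + 2 - 2 ^ Suc j = 0" using assms(2) by simp
next
  fix i assume "s + 2 - 2 ^ Suc i = 0"
  then have "(2::nat) ^ j < 2 ^ Suc i" using assms(1) by linarith
  then have "j < Suc i" by (subst (asm) power_strict_increasing_iff) auto
  then show "j \<le> i" by simp
qed

lemma code_length [simp]: "code_length (str_code \<sigma>) = length \<sigma>"
  using str_code_bounds by (rule code_length_eqI)

text \<open>Between consecutive powers of 2, with \<open>L + 1\<close> running from \<open>2 ^ j\<close> to \<open>2 ^ (j + 1) - 1\<close>, this function
  counts from 0 to \<open>2 ^ j - 1\<close>; hence it takes every value infinitely often. It selects the
  program that is named by the length \<open>L\<close> of a string.\<close>

definition recurrent :: "nat \<Rightarrow> nat" where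
  "recurrent L = Suc L - 2 ^ code_length L"

lemma recurrent_infinitely_often: "\<exists>L\<ge>N. recurrent L = n"
proof -
  define j where "j = n + N"
  have "n + N < 2 ^ j" unfolding j_def by (rule less_exp)
  then have "n < 2 ^ j" "N < 2 ^ j" by linarith+
  then have "code_length (2 ^ j + n - 1) = j"
    by (intro code_length_eqI) auto
  then have "recurrent (2 ^ j + n - 1) = n"
    using \<open>n < 2 ^ j\<close> by (simp add: recurrent_def)
  moreover have "N \<le> 2 ^ j + n - 1" using \<open>N < 2 ^ j\<close> by simp
  ultimately show ?thesis by blast
qed

lemma recursive_code_length:
  assumes "recursive k a"
  shows "recursive k (\<lambda>xs. code_length (a xs))"
proof (rule recursive_compose1[OF _ assms])
  show "recursive 1 (\<lambda>xs. code_length (xs ! 0))"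
    unfolding code_length_def
  proof (rule recursive_Least)
    show "recursive (Suc 1) (\<lambda>ys. tl ys ! 0 + 2 - 2 ^ Suc (hd ys))"
      by (intro recursive_intros; simp)
    show "\<exists>n. xs ! 0 + 2 - 2 ^ Suc n = 0" for xs :: "nat list"
    proof
      have "xs ! 0 < 2 ^ (xs ! 0)" by (rule less_exp)
      then show "xs ! 0 + 2 - 2 ^ Suc (xs ! 0) = 0" unfolding power_Suc by linarith
    qed
  qed
qed

section \<open>Cylinders and branches in Cantor space\<close>

lemma length_initseg [simp]: "length (initseg X n) = n"
  by (simp add: initseg_def)

lemma take_initseg: "take m (initseg X n) = initseg X (min m n)"
  by (simp add: initseg_def take_map min_def)

lemma initseg_Suc: "initseg X (Suc n) = initseg X n @ [X n]"
  by (simp add: initseg_def)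

lemma mem_cylinder: "X \<in> cylinder \<sigma> \<longleftrightarrow> initseg X (length \<sigma>) = \<sigma>"
  by (simp add: cylinder_def)

lemma mem_cylinder_initseg: "X \<in> cylinder (initseg X n)"
  by (simp add: mem_cylinder)

lemma cylinder_antimono: "prefix \<sigma> \<tau> \<Longrightarrow> cylinder \<tau> \<subseteq> cylinder \<sigma>"
proof
  fix X assume "prefix \<sigma> \<tau>" "X \<in> cylinder \<tau>"
  then have "take (length \<sigma>) (initseg X (length \<tau>)) = \<sigma>" "length \<sigma> \<le> length \<tau>"
    by (auto simp: prefix_def mem_cylinder)
  then show "X \<in> cylinder \<sigma>" by (simp add: take_initseg mem_cylinder min_def split: if_splits)
qed

lemma cylinder_split: "cylinder \<sigma> = cylinder (\<sigma> @ [False]) \<union> cylinder (\<sigma> @ [True])"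
  by (auto simp: mem_cylinder initseg_Suc)

lemma cylinder_sets: "cylinder \<sigma> \<in> sets borel"
proof -
  have "open {X :: cantor. X i = b}" for i b
    using open_vimage[of "{b}" "\<lambda>X :: cantor. X i"] continuous_on_product_coordinates[of i]
    by (simp add: Topological_Spaces.open_discrete vimage_def)
  then have m: "{X :: cantor. X i = b} \<in> sets borel" for i b by simp
  have "{X :: cantor. \<forall>i<n. X i = \<sigma> ! i} \<in> sets borel" for n
  proof (induction n)
    case (Suc n)
    have "{X :: cantor. \<forall>i<Suc n. X i = \<sigma> ! i} = {X. \<forall>i<n. X i = \<sigma> ! i} \<inter> {X. X n = \<sigma> ! n}"
      by (auto simp: less_Suc_eq)
    then show ?case using sets.Int[OF Suc m] by (simp only:)
  qed simp
  moreover have "cylinder \<sigma> = {X. \<forall>i<length \<sigma>. X i = \<sigma> ! i}"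
    unfolding cylinder_def initseg_def by (subst list_eq_iff_nth_eq) simp
  ultimately show ?thesis by (simp only:)
qed

text \<open>Call a string big if it has extensions of every length from its own on that satisfy \<open>P\<close>. One of the two
  successors of a big string is big again: otherwise extensions would be missing from some length
  on, for both successors and thus for the string. So big strings can be extended for ever.\<close>

lemma Koenig_binary_tree:
  assumes "\<And>n. \<exists>\<sigma>. length \<sigma> = n \<and> P \<sigma>" "\<And>\<sigma> \<tau>. prefix \<sigma> \<tau> \<Longrightarrow> P \<tau> \<Longrightarrow> P \<sigma>"
  shows "\<exists>X. \<forall>n. P (initseg X n)"
proof -
  define big where "big \<sigma> \<longleftrightarrow> (\<forall>n\<ge>length \<sigma>. \<exists>\<tau>. prefix \<sigma> \<tau> \<and> length \<tau> = n \<and> P \<tau>)" for \<sigma>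
  have step: "\<exists>b. big (\<sigma> @ [b])" if "big \<sigma>" for \<sigma>
  proof (rule ccontr)
    assume "\<nexists>b. big (\<sigma> @ [b])"
    then have "\<forall>b. \<exists>n\<ge>Suc (length \<sigma>). \<forall>\<tau>. prefix (\<sigma> @ [b]) \<tau> \<longrightarrow> length \<tau> = n \<longrightarrow> \<not> P \<tau>"
      unfolding big_def by (metis length_append_singleton)
    then obtain N where N: "\<And>b. N b \<ge> Suc (length \<sigma>)"
      "\<And>b \<tau>. prefix (\<sigma> @ [b]) \<tau> \<Longrightarrow> length \<tau> = N b \<Longrightarrow> \<not> P \<tau>"
      by metis
    define n where "n = max (N False) (N True)"
    have n: "N b \<le> n" for b by (cases b) (auto simp: n_def)
    obtain \<tau> where \<tau>: "prefix \<sigma> \<tau>" "length \<tau> = n" "P \<tau>"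
      using \<open>big \<sigma>\<close> n[of True] N(1)[of True] unfolding big_def
      by (metis Suc_leD le_trans)
    then obtain \<zeta> where \<zeta>: "\<tau> = \<sigma> @ \<zeta>" by (auto simp: prefix_def)
    moreover have "\<zeta> \<noteq> []"
      using \<zeta> \<tau>(2) n[of True] N(1)[of True] by auto
    ultimately obtain b \<rho> where \<rho>: "\<tau> = (\<sigma> @ [b]) @ \<rho>" by (cases \<zeta>) auto
    have "take (N b) \<tau> = (\<sigma> @ [b]) @ take (N b - Suc (length \<sigma>)) \<rho>"
      unfolding \<rho> take_append using N(1)[of b] by simp
    then have "prefix (\<sigma> @ [b]) (take (N b) \<tau>)" by (metis prefixI)
    moreover have "P (take (N b) \<tau>)"
      using \<tau>(3) by (rule assms(2)[rotated]) (rule take_is_prefix)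
    ultimately show False using N(2)[of b "take (N b) \<tau>"] \<tau>(2) n[of b] by simp
  qed
  have "\<exists>f. \<forall>n. (big (f n) \<and> length (f n) = n) \<and> (\<exists>b. f (Suc n) = f n @ [b])"
  proof (rule dependent_nat_choice)
    show "\<exists>x. big x \<and> length x = 0" using assms(1) by (auto simp: big_def)
  qed (use step in fastforce)
  then obtain f where f: "\<And>n. big (f n)" "\<And>n. length (f n) = n" "\<And>n. \<exists>b. f (Suc n) = f n @ [b]"
    by blast
  have "f n = initseg (\<lambda>n. last (f (Suc n))) n" for n
  proof (induction n)
    case 0
    then show ?case using f(2)[of 0] by (simp add: initseg_def)
  next
    case (Suc n)
    then show ?case using f(3)[of n] by (auto simp: initseg_Suc)
  qed
  moreover have "P (f n)" for n
    using f(1,2)[of n] assms(2) unfolding big_def by blast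
  ultimately show ?thesis by metis
qed

section \<open>Granularity of a continuous measure\<close>

lemma measure_cylinder_antimono:
  assumes "cantor_measure \<mu>" "prefix \<sigma> \<tau>"
  shows "measure \<mu> (cylinder \<tau>) \<le> measure \<mu> (cylinder \<sigma>)"
proof -
  interpret prob_space \<mu> using assms(1) by (simp add: cantor_measure_def)
  show ?thesis
    using assms cylinder_sets by (intro finite_measure_mono cylinder_antimono) (auto simp: cantor_measure_def)
qed

text \<open>Halving argument: one half of a cylinder has at least half of its measure. This bounds the inverse
  granularity and shows that it is defined.\<close>

lemma exists_heavy_string:
  assumes "cantor_measure \<mu>"
  shows "\<exists>\<sigma>. length \<sigma> = n \<and> 1 / 2 ^ n \<le> measure \<mu> (cylinder \<sigma>)"
proof (induction n)
  case 0
  interpret prob_space \<mu> using assms by (simp add: cantor_measure_def)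
  have "space \<mu> = UNIV" using assms sets_eq_imp_space_eq[of \<mu> borel] by (auto simp: cantor_measure_def)
  then show ?case using prob_space by (auto simp: cylinder_def initseg_def)
next
  case (Suc n)
  then obtain \<sigma> where \<sigma>: "length \<sigma> = n" "1 / 2 ^ n \<le> measure \<mu> (cylinder \<sigma>)" by blast
  have "measure \<mu> (cylinder \<sigma>) \<le> measure \<mu> (cylinder (\<sigma> @ [False])) + measure \<mu> (cylinder (\<sigma> @ [True]))"
    unfolding cylinder_split[of \<sigma>] using assms cylinder_sets
    by (intro measure_Un_le) (auto simp: cantor_measure_def)
  moreover have "1 / 2 ^ n = 1 / 2 ^ Suc n + 1 / (2::real) ^ Suc n" by simp
  ultimately have "1 / 2 ^ Suc n \<le> measure \<mu> (cylinder (\<sigma> @ [False])) \<or>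
      1 / 2 ^ Suc n \<le> measure \<mu> (cylinder (\<sigma> @ [True]))"
    using \<sigma>(2) by linarith
  then obtain b where "1 / 2 ^ Suc n \<le> measure \<mu> (cylinder (\<sigma> @ [b]))" by blast
  then show ?case using \<sigma>(1) by (intro exI[of _ "\<sigma> @ [b]"]) simp
qed

text \<open>If strings of measure at least \<open>\<epsilon>\<close> existed at every length, they would form an infinite binary tree,
  and a branch \<open>X\<close> would carry a point mass: the cylinders of its initial segments decrease to
  \<open>{X}\<close>.\<close>

lemma cylinders_uniformly_small:
  assumes "cantor_measure \<mu>" "continuous_measure \<mu>" "0 < \<epsilon>"
  shows "\<exists>l. \<forall>\<sigma>. length \<sigma> = l \<longrightarrow> measure \<mu> (cylinder \<sigma>) < \<epsilon>"
proof (rule ccontr)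
  interpret prob_space \<mu> using assms(1) by (simp add: cantor_measure_def)
  assume "\<nexists>l. \<forall>\<sigma>. length \<sigma> = l \<longrightarrow> measure \<mu> (cylinder \<sigma>) < \<epsilon>"
  then have "\<exists>\<sigma>. length \<sigma> = l \<and> \<epsilon> \<le> measure \<mu> (cylinder \<sigma>)" for l
    by (auto simp: not_less)
  then obtain X where X: "\<And>n. \<epsilon> \<le> measure \<mu> (cylinder (initseg X n))"
    using Koenig_binary_tree[of "\<lambda>\<sigma>. \<epsilon> \<le> measure \<mu> (cylinder \<sigma>)"] measure_cylinder_antimono[OF assms(1)]
    by (metis order_trans)
  have "(\<lambda>n. measure \<mu> (cylinder (initseg X n))) \<longlonglongrightarrow> measure \<mu> (\<Inter>n. cylinder (initseg X n))"
  proof (rule finite_Lim_measure_decseq)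
    show "range (\<lambda>n. cylinder (initseg X n)) \<subseteq> sets \<mu>"
      using assms(1) cylinder_sets by (auto simp: cantor_measure_def)
    show "decseq (\<lambda>n. cylinder (initseg X n))"
      by (rule decseq_SucI) (simp add: cylinder_antimono initseg_Suc)
  qed
  moreover have "Y = X" if "\<forall>n. Y \<in> cylinder (initseg X n)" for Y
  proof
    fix n show "Y n = X n"
      using that[rule_format, of "Suc n"] by (simp add: mem_cylinder initseg_Suc)
  qed
  then have "(\<Inter>n. cylinder (initseg X n)) = {X}"
    using mem_cylinder_initseg by blast
  ultimately have "(\<lambda>n. measure \<mu> (cylinder (initseg X n))) \<longlonglongrightarrow> 0"
    using assms(2) by (simp add: continuous_measure_def)
  then have "\<epsilon> \<le> 0" by (rule LIMSEQ_le_const) (use X in blast)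
  then show False using assms(3) by simp
qed

text \<open>From left to right this is minimality of the granularity. From right to left, prefixes of heavy strings
  are heavy, so no length up to that of a heavy string can be the granularity.\<close>

lemma less_granularity_iff:
  assumes "cantor_measure \<mu>" "continuous_measure \<mu>"
  shows "n < granularity \<mu> k \<longleftrightarrow> (\<exists>\<sigma>. length \<sigma> = n \<and> 1 / 2 ^ k \<le> measure \<mu> (cylinder \<sigma>))"
proof
  assume "n < granularity \<mu> k"
  from not_less_Least[OF this[unfolded granularity_def]]
  show "\<exists>\<sigma>. length \<sigma> = n \<and> 1 / 2 ^ k \<le> measure \<mu> (cylinder \<sigma>)" by (auto simp: not_less)
next
  assume "\<exists>\<sigma>. length \<sigma> = n \<and> 1 / 2 ^ k \<le> measure \<mu> (cylinder \<sigma>)"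
  then obtain \<sigma> where \<sigma>: "length \<sigma> = n" "1 / 2 ^ k \<le> measure \<mu> (cylinder \<sigma>)" by blast
  have small: "\<forall>\<sigma>. length \<sigma> = granularity \<mu> k \<longrightarrow> measure \<mu> (cylinder \<sigma>) < 1 / 2 ^ k"
    unfolding granularity_def by (rule LeastI_ex) (rule cylinders_uniformly_small[OF assms], simp)
  show "n < granularity \<mu> k"
  proof (rule ccontr)
    assume "\<not> n < granularity \<mu> k"
    then have "measure \<mu> (cylinder (take (granularity \<mu> k) \<sigma>)) < 1 / 2 ^ k"
      using small \<sigma>(1) by simp
    moreover have "measure \<mu> (cylinder \<sigma>) \<le> measure \<mu> (cylinder (take (granularity \<mu> k) \<sigma>))"
      using assms(1) take_is_prefix by (rule measure_cylinder_antimono)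
    ultimately show False using \<sigma>(2) by simp
  qed
qed

lemma order_inverse_0: "order_inverse g 0 = 0"
  by (simp add: order_inverse_def)

lemma order_inverse_granularity_Suc:
  assumes "cantor_measure \<mu>" "continuous_measure \<mu>"
  shows "order_inverse (granularity \<mu>) (Suc n) =
    (LEAST k. \<exists>\<sigma>. length \<sigma> = n \<and> 1 / 2 ^ k \<le> measure \<mu> (cylinder \<sigma>))"
  by (simp add: order_inverse_def Suc_le_eq less_granularity_iff[OF assms])

lemma order_inverse_granularity_mono:
  assumes "cantor_measure \<mu>" "continuous_measure \<mu>"
  shows "mono (order_inverse (granularity \<mu>))"
proof
  fix m n :: nat assume "m \<le> n"
  have "n < granularity \<mu> n"
    using less_granularity_iff[OF assms] exists_heavy_string[OF assms(1)] by blast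
  then have "n \<le> granularity \<mu> (order_inverse (granularity \<mu>) n)"
    unfolding order_inverse_def by (intro LeastI[of "\<lambda>k. n \<le> granularity \<mu> k" n]) simp
  then show "order_inverse (granularity \<mu>) m \<le> order_inverse (granularity \<mu>) n"
    using \<open>m \<le> n\<close> unfolding order_inverse_def[of _ m]
    by (intro Least_le[of "\<lambda>k. m \<le> granularity \<mu> k"]) simp
qed

lemma heavy_string_at_order_inverse:
  assumes "cantor_measure \<mu>" "continuous_measure \<mu>"
  obtains \<sigma> where "length \<sigma> = n" "1 / 2 ^ order_inverse (granularity \<mu>) (Suc n) \<le> measure \<mu> (cylinder \<sigma>)"
proof -
  have "\<exists>k \<sigma>. length \<sigma> = n \<and> 1 / 2 ^ k \<le> measure \<mu> (cylinder \<sigma>)"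
    using exists_heavy_string[OF assms(1)] by blast
  from LeastI_ex[OF this] show thesis
    unfolding order_inverse_granularity_Suc[OF assms, symmetric] using that by blast
qed

lemma order_inverse_granularity_Suc_le:
  assumes "cantor_measure \<mu>" "continuous_measure \<mu>" "1 / 2 ^ k \<le> measure \<mu> (cylinder \<sigma>)"
  shows "order_inverse (granularity \<mu>) (Suc (length \<sigma>)) \<le> k"
  unfolding order_inverse_granularity_Suc[OF assms(1,2)]
  using assms(3) by (intro Least_le[of "\<lambda>k. \<exists>\<tau>. length \<tau> = length \<sigma> \<and> 1 / 2 ^ k \<le> measure \<mu> (cylinder \<tau>)"]) blast

lemma order_inverse_granularity_unbounded:
  assumes "cantor_measure \<mu>" "continuous_measure \<mu>"
  shows "\<exists>n. b < order_inverse (granularity \<mu>) (Suc n)"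
proof -
  obtain l where l: "\<And>\<sigma>. length \<sigma> = l \<Longrightarrow> measure \<mu> (cylinder \<sigma>) < 1 / 2 ^ b"
    using cylinders_uniformly_small[OF assms, of "1 / 2 ^ b"] by auto
  obtain \<sigma> where "length \<sigma> = l" "1 / 2 ^ order_inverse (granularity \<mu>) (Suc l) \<le> measure \<mu> (cylinder \<sigma>)"
    using heavy_string_at_order_inverse[OF assms] by blast
  with l[of \<sigma>] have "1 / 2 ^ order_inverse (granularity \<mu>) (Suc l) < 1 / (2::real) ^ b" by simp
  then have "(2::real) ^ b < 2 ^ order_inverse (granularity \<mu>) (Suc l)" by (simp add: divide_simps)
  then have "b < order_inverse (granularity \<mu>) (Suc l)" by simp
  then show ?thesis by blast
qed

text \<open>Let \<open>n = length \<sigma>\<close>. Strings of length \<open>n\<close> are governed by the value at \<open>n + 1\<close>, but by monotonicity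
  that is at least the value at \<open>n\<close>. If the latter is \<open>k + 1\<close>, minimality excludes \<open>k\<close>; if it is 0,
  truncated subtraction leaves the trivial bound 1.\<close>

lemma measure_cylinder_le_order_inverse:
  assumes "cantor_measure \<mu>" "continuous_measure \<mu>"
  shows "measure \<mu> (cylinder \<sigma>) \<le> 1 / 2 ^ (order_inverse (granularity \<mu>) (length \<sigma>) - 1)"
proof (cases "order_inverse (granularity \<mu>) (length \<sigma>)")
  case 0
  interpret prob_space \<mu> using assms(1) by (simp add: cantor_measure_def)
  show ?thesis using 0 by simp
next
  case (Suc k)
  have "\<not> 1 / 2 ^ k \<le> measure \<mu> (cylinder \<sigma>)"
  proof
    assume "1 / 2 ^ k \<le> measure \<mu> (cylinder \<sigma>)"
    from order_inverse_granularity_Suc_le[OF assms this]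
      monoD[OF order_inverse_granularity_mono[OF assms], of "length \<sigma>" "Suc (length \<sigma>)"]
    show False using Suc by simp
  qed
  then show ?thesis using Suc by simp
qed

section \<open>A computable order close to the inverse granularity\<close>

primrec running_max :: "(nat \<Rightarrow> nat) \<Rightarrow> nat \<Rightarrow> nat" where
  "running_max f 0 = 0"
| "running_max f (Suc n) = max (running_max f n) (f n)"

lemma computable_running_max:
  assumes "computable f"
  shows "computable (running_max f)"
  unfolding computable_iff_recursive
proof (rule recursive_primrec1)
  show "recursive 2 (\<lambda>ys. ys ! 0 + (f (ys ! 1) - ys ! 0))"
    by (intro recursive_intros recursive_computable[OF assms]; simp)
qed (simp add: max_def)

lemma is_order_running_max:
  assumes "\<And>b. \<exists>n. b \<le> f n"
  shows "is_order (running_max f)"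
  unfolding is_order_def
proof (intro conjI allI)
  show "mono (running_max f)" by (simp add: mono_iff_le_Suc)
  fix b
  obtain n where "b \<le> f n" using assms by blast
  then have "b \<le> running_max f (Suc n)" by simp
  then show "\<exists>n. b \<le> running_max f n" by blast
qed simp

text \<open>Passing to the running maximum does not increase the distance to \<open>g\<close>, since all earlier values of a
  monotone \<open>g\<close> lie below the present one. The index shift leaves room for the value 0 at 0 that an
  order must have.\<close>

lemma running_max_close:
  assumes "mono g" "g 0 = 0"
    and "\<And>n. f n \<le> g (Suc n) + d" "\<And>n. g (Suc n) \<le> f n + d"
  shows "running_max f n \<le> g n + d" "g n \<le> running_max f n + d"
proof -
  show "running_max f n \<le> g n + d"
  proof (induction n)
    case (Suc n)
    have "g n \<le> g (Suc n)" using assms(1) by (rule monoD) simp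
    then show ?case using Suc assms(3)[of n] by simp
  qed simp
  show "g n \<le> running_max f n + d"
    using assms(2) assms(4)[of "n - 1"] by (cases n) (auto simp: max_def)
qed

text \<open>Here \<open>q\<close> stands for rational approximations, \<open>q s k\<close> being within \<open>1 / 2 ^ k\<close> of the measure of the
  string with code \<open>s\<close>. Taking precision \<open>j + 1\<close> when comparing with \<open>1 / 2 ^ j\<close> keeps the error at
  half of the threshold.\<close>

definition log_estimate :: "(nat \<Rightarrow> nat \<Rightarrow> real) \<Rightarrow> nat \<Rightarrow> nat" where
  "log_estimate q n = (LEAST j. \<exists>\<sigma>. length \<sigma> = n \<and> 1 / 2 ^ j \<le> q (str_code \<sigma>) (Suc j))"

lemma computable_log_estimate:
  assumes "computable2 a" "computable2 b" "computable2 c"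
    and q: "\<And>s k. q s k = (real (a s k) - real (b s k)) / (real (c s k) + 1)"
    and ex: "\<And>n. \<exists>j \<sigma>. length \<sigma> = n \<and> 1 / 2 ^ j \<le> q (str_code \<sigma>) (Suc j)"
  shows "computable (log_estimate q)"
proof -
  \<comment> \<open>A vanishing sum of truncated differences expresses a conjunction of equations and inequalities.\<close>
  define e where "e j n s = (code_length s - n) + (n - code_length s) +
    (Suc (c s (Suc j)) + b s (Suc j) * 2 ^ j - a s (Suc j) * 2 ^ j)" for j n s
  have e: "e j n (str_code \<sigma>) = 0 \<longleftrightarrow> length \<sigma> = n \<and> 1 / 2 ^ j \<le> q (str_code \<sigma>) (Suc j)"
    (is "_ \<longleftrightarrow> _ \<and> ?heavy") for j n \<sigma>
  proof -
    let ?s = "str_code \<sigma>"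
    have "?heavy \<longleftrightarrow> real (c ?s (Suc j)) + 1 \<le> (real (a ?s (Suc j)) - real (b ?s (Suc j))) * 2 ^ j"
      unfolding q by (simp add: divide_simps mult.commute)
    also have "\<dots> \<longleftrightarrow> real (Suc (c ?s (Suc j)) + b ?s (Suc j) * 2 ^ j) \<le> real (a ?s (Suc j) * 2 ^ j)"
      by (simp add: algebra_simps)
    also have "\<dots> \<longleftrightarrow> Suc (c ?s (Suc j)) + b ?s (Suc j) * 2 ^ j \<le> a ?s (Suc j) * 2 ^ j"
      by (rule of_nat_le_iff)
    finally show ?thesis by (auto simp: e_def)
  qed
  \<comment> \<open>The bounded quantifier over strings of length \<open>n\<close>, as a count of witnesses among the numbers below
    \<open>2 ^ (n + 1)\<close>, which include all codes of such strings.\<close>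
  define m where "m j n = (\<Sum>s<2 ^ Suc n. 1 - e j n s)" for j n
  have "m j n = 0 \<longleftrightarrow> (\<forall>s<2 ^ Suc n. e j n s \<noteq> 0)" for j n
    by (simp add: m_def Ball_def Suc_le_eq)
  moreover have "str_code \<sigma> < 2 ^ Suc n" if "e j n (str_code \<sigma>) = 0" for j n \<sigma>
  proof -
    have "length \<sigma> = n" using that by (simp only: e)
    then show ?thesis using str_code_bounds(2)[of \<sigma>] by simp
  qed
  ultimately have "(\<exists>\<sigma>. e j n (str_code \<sigma>) = 0) \<longleftrightarrow> m j n \<noteq> 0" for j n
    using surj_str_code by metis
  then have search: "(\<exists>\<sigma>. length \<sigma> = n \<and> 1 / 2 ^ j \<le> q (str_code \<sigma>) (Suc j)) \<longleftrightarrow> 1 - m j n = 0" for j n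
    unfolding e by (simp add: Suc_le_eq)
  have "recursive 1 (\<lambda>xs. LEAST j. 1 - m j (xs ! 0) = 0)"
  proof (rule recursive_Least)
    show "recursive (Suc 1) (\<lambda>ys. 1 - m (hd ys) (tl ys ! 0))"
      unfolding m_def
    proof (intro recursive_diff recursive_const recursive_sum)
      show "recursive (Suc 1) (\<lambda>ys. 2 ^ Suc (tl ys ! 0))"
        by (intro recursive_intros; simp)
      show "recursive (Suc (Suc 1)) (\<lambda>ys. e (hd (tl ys)) (tl (tl ys) ! 0) (hd ys))"
        unfolding e_def
        by (intro recursive_intros recursive_code_length assms(1-3)[THEN recursive_computable2]; simp)
    qed
    show "\<exists>j. 1 - m j (xs ! 0) = 0" for xs
      using ex[of "xs ! 0"] unfolding search .
  qed
  then show ?thesis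
    unfolding computable_iff_recursive log_estimate_def search .
qed

text \<open>A string of measure \<open>1 / 2 ^ g\<close> or more passes the approximate comparison at \<open>j = g + 1\<close>, since
  \<open>1 / 2 ^ g - 1 / 2 ^ (g + 2) \<ge> 1 / 2 ^ (g + 1)\<close>. Conversely, passing it at \<open>j\<close> certifies measure at least
  \<open>1 / 2 ^ j - 1 / 2 ^ (j + 1) = 1 / 2 ^ (j + 1)\<close>. The first conclusion guarantees that the search terminates.\<close>

lemma log_estimate_close:
  assumes "cantor_measure \<mu>" "continuous_measure \<mu>"
    and close: "\<And>\<sigma> k. \<bar>measure \<mu> (cylinder \<sigma>) - q (str_code \<sigma>) k\<bar> \<le> 1 / 2 ^ k"
  shows "\<exists>j \<sigma>. length \<sigma> = n \<and> 1 / 2 ^ j \<le> q (str_code \<sigma>) (Suc j)"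
    and "log_estimate q n \<le> order_inverse (granularity \<mu>) (Suc n) + 1"
    and "order_inverse (granularity \<mu>) (Suc n) \<le> log_estimate q n + 1"
proof -
  define P where "P j \<longleftrightarrow> (\<exists>\<sigma>. length \<sigma> = n \<and> 1 / 2 ^ j \<le> q (str_code \<sigma>) (Suc j))" for j
  define g where "g = order_inverse (granularity \<mu>) (Suc n)"
  obtain \<sigma> where \<sigma>: "length \<sigma> = n" "1 / 2 ^ g \<le> measure \<mu> (cylinder \<sigma>)"
    using heavy_string_at_order_inverse[OF assms(1,2), of n] unfolding g_def by blast
  have "measure \<mu> (cylinder \<sigma>) - 1 / 2 ^ Suc (Suc g) \<le> q (str_code \<sigma>) (Suc (Suc g))"
    using close[of \<sigma> "Suc (Suc g)"] unfolding abs_le_iff by linarith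
  moreover have "1 / 2 ^ g = 4 * (1 / (2::real) ^ Suc (Suc g))" "1 / 2 ^ Suc g = 2 * (1 / (2::real) ^ Suc (Suc g))"
    by simp_all
  moreover have "0 \<le> 1 / (2::real) ^ Suc (Suc g)" by simp
  ultimately have "1 / 2 ^ Suc g \<le> q (str_code \<sigma>) (Suc (Suc g))" using \<sigma>(2) by linarith
  then have P: "P (Suc g)" using \<sigma>(1) by (auto simp only: P_def)
  then show "\<exists>j \<sigma>. length \<sigma> = n \<and> 1 / 2 ^ j \<le> q (str_code \<sigma>) (Suc j)"
    unfolding P_def by blast
  have least: "log_estimate q n = (LEAST j. P j)"
    by (simp only: log_estimate_def P_def)
  show "log_estimate q n \<le> g + 1"
    unfolding least using Least_le[of P, OF P] by simp
  define j where "j = log_estimate q n"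
  have "P j" unfolding j_def least using P by (rule LeastI)
  then obtain \<tau> where \<tau>: "length \<tau> = n" "1 / 2 ^ j \<le> q (str_code \<tau>) (Suc j)"
    by (auto simp only: P_def)
  have "q (str_code \<tau>) (Suc j) - 1 / 2 ^ Suc j \<le> measure \<mu> (cylinder \<tau>)"
    using close[of \<tau> "Suc j"] unfolding abs_le_iff by linarith
  moreover have "1 / 2 ^ j = 2 * (1 / (2::real) ^ Suc j)" by simp
  ultimately have "1 / 2 ^ Suc j \<le> measure \<mu> (cylinder \<tau>)" using \<tau>(2) by linarith
  from order_inverse_granularity_Suc_le[OF assms(1,2) this]
  show "g \<le> log_estimate q n + 1" using \<tau>(1) by (simp add: g_def j_def)
qed

section \<open>Complexity of random sequences\<close>

text \<open>If \<open>N\<close> is at least every length in \<open>A\<close>, each \<open>p\<close> has \<open>2 ^ (N - length p)\<close> extensions of length \<open>N\<close>. By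
  prefix-freeness different elements of \<open>A\<close> have no common extension, and there are only \<open>2 ^ N\<close> strings
  of length \<open>N\<close> altogether.\<close>

lemma Kraft_finite:
  assumes "finite A" "\<And>p q. p \<in> A \<Longrightarrow> q \<in> A \<Longrightarrow> prefix p q \<Longrightarrow> p = q"
  shows "(\<Sum>p\<in>A. 1 / 2 ^ length (p :: bool list)) \<le> (1 :: real)"
proof -
  define N where "N = Max (insert 0 (length ` A))"
  have N: "length p \<le> N" if "p \<in> A" for p using that assms(1) by (auto simp: N_def)
  define E where "E p = (@) p ` {\<rho> :: bool list. length \<rho> = N - length p}" for p
  have fin: "finite {\<rho> :: bool list. length \<rho> = n}" for n
    using finite_lists_length_eq[of "UNIV :: bool set" n] by simp
  have cardE: "card (E p) = 2 ^ (N - length p)" for p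
    using card_lists_length_eq[of "UNIV :: bool set" "N - length p"]
    by (simp add: E_def card_image inj_on_def)
  have "(\<Sum>p\<in>A. card (E p)) = card (\<Union>p\<in>A. E p)"
  proof (rule card_UN_disjoint[symmetric])
    show "\<forall>p\<in>A. \<forall>q\<in>A. p \<noteq> q \<longrightarrow> E p \<inter> E q = {}"
    proof (intro ballI impI)
      fix p q assume pq: "p \<in> A" "q \<in> A" "p \<noteq> q"
      then have "\<not> prefix p q" "\<not> prefix q p" using assms(2) by blast+
      then show "E p \<inter> E q = {}"
        by (auto simp: E_def dest!: append_eq_append_conv2[THEN iffD1])
    qed
  qed (use assms(1) in \<open>auto simp: E_def fin\<close>)
  also have "\<dots> \<le> card {\<tau> :: bool list. length \<tau> = N}"
    by (intro card_mono fin) (auto simp: E_def N)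
  also have "\<dots> = 2 ^ N"
    using card_lists_length_eq[of "UNIV :: bool set" N] by simp
  finally have "real (\<Sum>p\<in>A. 2 ^ (N - length p)) \<le> real (2 ^ N)"
    unfolding cardE by (simp only: of_nat_le_iff)
  then have "(\<Sum>p\<in>A. 2 ^ (N - length p)) \<le> (2 :: real) ^ N" by simp
  also have "(\<Sum>p\<in>A. 2 ^ (N - length p)) = 2 ^ N * (\<Sum>p\<in>A. 1 / 2 ^ length p :: real)"
    unfolding sum_distrib_left by (intro sum.cong refl) (simp add: power_diff N)
  finally show ?thesis by simp
qed

definition complexity_test :: "(bool list \<Rightarrow> bool list option) \<Rightarrow> (nat \<Rightarrow> nat) \<Rightarrow> nat \<Rightarrow> cantor set" where
  "complexity_test U h i = \<Union> {cylinder \<sigma> | \<sigma>. \<exists>p. U p = Some \<sigma> \<and> length p + i \<le> h (length \<sigma>)}"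

text \<open>Level \<open>i\<close> is enumerated as follows. On input \<open>\<tau>\<close>, let \<open>p\<close> be the program with code
  \<open>recurrent (length \<tau>)\<close>, run \<open>U\<close> on \<open>p\<close>, and if this yields \<open>\<sigma>\<close>, halt iff \<open>\<sigma>\<close> is a prefix of \<open>\<tau>\<close> and
  \<open>length p + i \<le> h (length \<sigma>)\<close>. Accepted strings clearly have their cylinder inside the test.
  Conversely, let \<open>p\<close> describe \<open>\<sigma>\<close> and satisfy the inequality. Some length \<open>L \<ge> length \<sigma>\<close> names \<open>p\<close>, so all
  extensions of \<open>\<sigma>\<close> of length \<open>L\<close> are accepted, and their cylinders cover that of \<open>\<sigma>\<close>. Only one
  computation of \<open>U\<close> is followed for each \<open>\<tau>\<close>, and if it diverges, so does the enumeration at \<open>\<tau>\<close>, as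
  it should.\<close>

lemma uniformly_Sigma1_complexity_test:
  assumes "partial_computable_str U" "computable h"
  shows "uniformly_Sigma1 (complexity_test U h)"
proof -
  obtain rU where rU: "\<And>p n. computes rU [str_code p] n \<longleftrightarrow> (\<exists>\<sigma>. U p = Some \<sigma> \<and> n = str_code \<sigma>)"
    using assms(1) by (auto simp: partial_computable_str_def)
  define prog where "prog s = recurrent (code_length s)" for s
  have prog: "recursive k (\<lambda>xs. prog (a xs))" if "recursive k a" for k a
    unfolding prog_def recurrent_def using that by (intro recursive_intros recursive_code_length)
  \<comment> \<open>Zero iff \<open>x\<close> witnesses that the string with code \<open>u\<close> is a prefix of the one with code \<open>s\<close>, and the
    length condition holds.\<close>
  define e where "e x i s u = (s - (u + 2 ^ code_length u * x)) + (u + 2 ^ code_length u * x - s)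
    + (code_length (prog s) + i - h (code_length u))" for x i s u
  have "recursive 2 (\<lambda>ys. prog (ys ! 1))"
    by (intro prog recursive_nth) simp
  then obtain rP where "\<And>ys. length ys = 2 \<Longrightarrow> computes rP ys (prog (ys ! 1))"
    by (auto simp: recursive_def)
  from this[of "[_, _]"] have rP: "computes rP [i, s] y \<longleftrightarrow> y = prog s" for i s y
    by (simp add: computes_iff_eq)
  have "recursive (Suc 3) (\<lambda>xs. e (xs ! 0) (xs ! 1) (xs ! 2) (xs ! 3))"
    unfolding e_def
    by (intro recursive_intros recursive_code_length prog recursive_computable[OF assms(2)]; simp)
  then obtain rC where "\<And>xs. length xs = 3 \<Longrightarrow>
      (\<forall>n. computes rC xs n \<longrightarrow> e n (xs ! 0) (xs ! 1) (xs ! 2) = 0) \<and>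
      ((\<exists>n. e n (xs ! 0) (xs ! 1) (xs ! 2) = 0) \<longrightarrow>
         computes rC xs (LEAST n. e n (xs ! 0) (xs ! 1) (xs ! 2) = 0))"
    using semidecidable_search[of 3 "\<lambda>xs. e (xs ! 0) (xs ! 1) (xs ! 2) (xs ! 3)"]
    by (auto simp: numeral_2_eq_2 numeral_3_eq_3)
  from this[of "[_, _, _]"]
  have rC: "(\<exists>y. computes rC [i, s, u] y) \<longleftrightarrow> (\<exists>x. e x i s u = 0)" for i s u
    by simp blast
  have e: "(\<exists>x. e x i (str_code \<tau>) (str_code \<sigma>) = 0) \<longleftrightarrow>
    prefix \<sigma> \<tau> \<and> code_length (prog (str_code \<tau>)) + i \<le> h (length \<sigma>)" for i \<sigma> \<tau>
  proof -
    have "e x i (str_code \<tau>) (str_code \<sigma>) = 0 \<longleftrightarrow> str_code \<tau> = str_code \<sigma> + 2 ^ length \<sigma> * x \<and>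
      code_length (prog (str_code \<tau>)) + i \<le> h (length \<sigma>)" for x
      unfolding e_def code_length by arith
    then show ?thesis by (simp add: prefix_iff_str_code)
  qed
  define r where "r = Comp rC [recf.Proj 0, recf.Proj 1, Comp rU [rP]]"
  have "computes (recf.Proj 0) [i, s] y \<longleftrightarrow> y = i" "computes (recf.Proj 1) [i, s] y \<longleftrightarrow> y = s" for i s y
    using computes.Proj[of 0 "[i, s]"] computes.Proj[of 1 "[i, s]"] by (simp_all add: computes_iff_eq)
  then have "computes r [i, s] y \<longleftrightarrow> (\<exists>u. computes rU [prog s] u \<and> computes rC [i, s, u] y)" for i s y
    unfolding r_def computes_Comp_iff by (auto simp: list_all2_Cons1 computes_Comp_iff rP)
  then have r: "(\<exists>y. computes r [i, s] y) \<longleftrightarrow> (\<exists>u. computes rU [prog s] u \<and> (\<exists>x. e x i s u = 0))" for i s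
    unfolding rC[symmetric] by blast
  have halts: "(\<exists>y. computes r [i, str_code \<tau>] y) \<longleftrightarrow>
    (\<exists>p \<sigma>. str_code p = recurrent (length \<tau>) \<and> U p = Some \<sigma> \<and> prefix \<sigma> \<tau> \<and> length p + i \<le> h (length \<sigma>))"
    for i \<tau>
  proof -
    obtain p where p: "str_code p = recurrent (length \<tau>)" using surj_str_code by blast
    then have "prog (str_code \<tau>) = str_code p" by (simp add: prog_def)
    then have "(\<exists>y. computes r [i, str_code \<tau>] y) \<longleftrightarrow>
      (\<exists>\<sigma>. U p = Some \<sigma> \<and> (\<exists>x. e x i (str_code \<tau>) (str_code \<sigma>) = 0))"
      unfolding r by (auto simp only: rU)
    then have "(\<exists>y. computes r [i, str_code \<tau>] y) \<longleftrightarrow>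
      (\<exists>\<sigma>. U p = Some \<sigma> \<and> prefix \<sigma> \<tau> \<and> length p + i \<le> h (length \<sigma>))"
      by (simp only: e \<open>prog (str_code \<tau>) = str_code p\<close> code_length)
    moreover have "str_code q = recurrent (length \<tau>) \<longleftrightarrow> q = p" for q
      unfolding p[symmetric] by (rule inj_eq[OF inj_str_code])
    ultimately show ?thesis by simp
  qed
  have "complexity_test U h i = \<Union> {cylinder \<tau> | \<tau>. \<exists>y. computes r [i, str_code \<tau>] y}" for i
  proof (intro equalityI subsetI)
    fix X assume "X \<in> complexity_test U h i"
    then obtain p \<sigma> where p: "U p = Some \<sigma>" "length p + i \<le> h (length \<sigma>)" "X \<in> cylinder \<sigma>"
      by (auto simp: complexity_test_def)
    obtain L where L: "L \<ge> length \<sigma>" "recurrent L = str_code p"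
      using recurrent_infinitely_often by blast
    have "take (length \<sigma>) (initseg X L) = \<sigma>"
      using p(3) L(1) by (simp add: take_initseg mem_cylinder)
    then have "prefix \<sigma> (initseg X L)" by (metis take_is_prefix)
    then have "\<exists>y. computes r [i, str_code (initseg X L)] y"
      unfolding halts using p L by auto
    then show "X \<in> \<Union> {cylinder \<tau> | \<tau>. \<exists>y. computes r [i, str_code \<tau>] y}"
      using mem_cylinder_initseg by blast
  next
    fix X assume "X \<in> \<Union> {cylinder \<tau> | \<tau>. \<exists>y. computes r [i, str_code \<tau>] y}"
    then show "X \<in> complexity_test U h i"
      using cylinder_antimono unfolding complexity_test_def halts by blast
  qed
  then show ?thesis unfolding uniformly_Sigma1_def by blast
qed

text \<open>Every cylinder in the test is charged to a description of its string. Kraft's inequality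
  bounds finite parts of the test uniformly, and these exhaust it from below.\<close>

lemma measure_complexity_test_le:
  assumes "cantor_measure \<mu>" "prefix_free_machine U"
    and small: "\<And>\<sigma>. measure \<mu> (cylinder \<sigma>) \<le> 1 / 2 ^ h (length \<sigma>)"
  shows "measure \<mu> (complexity_test U h i) \<le> 1 / 2 ^ i"
proof -
  interpret prob_space \<mu> using assms(1) by (simp add: cantor_measure_def)
  have cyl: "cylinder \<sigma> \<in> sets \<mu>" for \<sigma>
    using assms(1) cylinder_sets by (simp add: cantor_measure_def)
  \<comment> \<open>Bounding the length of the descriptions makes the index sets finite.\<close>
  define S where "S N = {p. length p < N \<and> U p \<noteq> None \<and> length p + i \<le> h (length (the (U p)))}" for N
  define A where "A N = (\<Union>p\<in>S N. cylinder (the (U p)))" for N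
  have fin: "finite (S N)" for N
    by (rule finite_subset[OF _ finite_lists_length_le[of "UNIV :: bool set" N]]) (auto simp: S_def)
  have "measure \<mu> (A N) \<le> 1 / 2 ^ i" for N
  proof -
    have "measure \<mu> (A N) \<le> (\<Sum>p\<in>S N. measure \<mu> (cylinder (the (U p))))"
      unfolding A_def using fin cyl by (rule measure_UNION_le)
    also have "\<dots> \<le> (\<Sum>p\<in>S N. 1 / 2 ^ i * (1 / 2 ^ length p))"
    proof (rule sum_mono)
      fix p assume "p \<in> S N"
      then have "(2::real) ^ (length p + i) \<le> 2 ^ h (length (the (U p)))"
        by (intro power_increasing) (auto simp: S_def)
      then have "1 / 2 ^ h (length (the (U p))) \<le> 1 / (2::real) ^ (length p + i)"
        by (intro divide_left_mono) auto
      with small[of "the (U p)"] have "measure \<mu> (cylinder (the (U p))) \<le> 1 / 2 ^ (length p + i)"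
        by (rule order_trans)
      then show "measure \<mu> (cylinder (the (U p))) \<le> 1 / 2 ^ i * (1 / 2 ^ length p)"
        by (simp add: power_add mult.commute)
    qed
    also have "\<dots> = 1 / 2 ^ i * (\<Sum>p\<in>S N. 1 / 2 ^ length p)"
      by (rule sum_distrib_left[symmetric])
    also have "\<dots> \<le> 1 / 2 ^ i * 1"
    proof (rule mult_left_mono)
      show "(\<Sum>p\<in>S N. 1 / 2 ^ length p) \<le> (1 :: real)"
        using assms(2) by (intro Kraft_finite fin) (auto simp: prefix_free_machine_def S_def)
    qed simp
    finally show ?thesis by simp
  qed
  moreover have "(\<lambda>N. measure \<mu> (A N)) \<longlonglongrightarrow> measure \<mu> (\<Union>N. A N)"
  proof (rule finite_Lim_measure_incseq)
    show "range A \<subseteq> sets \<mu>" using fin cyl by (auto simp: A_def)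
    show "incseq A" by (rule monoI) (auto simp: A_def S_def intro: less_le_trans)
  qed
  moreover have "(\<Union>N. A N) = complexity_test U h i"
    by (fastforce simp: A_def S_def complexity_test_def)
  ultimately show ?thesis by (metis LIMSEQ_le_const2)
qed

text \<open>This shows that a universal machine describes every string: otherwise the minimum defining \<open>K\<close>
  would be taken over the empty set.\<close>

lemma constant_machine: "prefix_free_machine (\<lambda>p. if p = [] then Some \<sigma> else None)"
proof -
  \<comment> \<open>Searching for a zero of a function that ignores the search variable and returns the input
    halts only on input 0, the code of the empty string.\<close>
  obtain rZ where rZ: "\<And>xs. length xs = 1 \<Longrightarrow> (\<forall>n. computes rZ xs n \<longrightarrow> (n # xs) ! 1 = 0) \<and>
    ((\<exists>n. (n # xs) ! 1 = 0) \<longrightarrow> computes rZ xs (LEAST n. (n # xs) ! 1 = 0))"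
    using semidecidable_search[OF recursive_nth[of 1 "Suc 1"]] by auto
  from rZ[of "[_]"] have Z: "(\<exists>y. computes rZ [x] y) \<longleftrightarrow> x = 0" for x
    by auto
  obtain rS where "\<And>xs. length xs = 1 \<Longrightarrow> computes rS xs (str_code \<sigma>)"
    using recursive_const[of 1 "str_code \<sigma>"] by (auto simp: recursive_def)
  from this[of "[_]"] have "computes rS [x] n \<longleftrightarrow> n = str_code \<sigma>" for x n
    by (simp add: computes_iff_eq)
  then have "computes (Comp rS [rZ]) [x] n \<longleftrightarrow> (\<exists>y. computes rZ [x] y) \<and> n = str_code \<sigma>" for x n
    unfolding computes_Comp_iff by (auto simp: list_all2_Cons1)
  then have "computes (Comp rS [rZ]) [x] n \<longleftrightarrow> x = 0 \<and> n = str_code \<sigma>" for x n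
    unfolding Z .
  moreover have "str_code p = 0 \<longleftrightarrow> p = []" for p
    by (cases p) auto
  ultimately have "partial_computable_str (\<lambda>p. if p = [] then Some \<sigma> else None)"
    unfolding partial_computable_str_def by (intro exI[of _ "Comp rS [rZ]"]) auto
  then show ?thesis by (auto simp: prefix_free_machine_def split: if_splits)
qed

lemma K_attained:
  assumes "universal_prefix_free_machine U"
  obtains p where "U p = Some \<sigma>" "length p = K U \<sigma>"
proof -
  define M where "M = (\<lambda>p :: bool list. if p = [] then Some \<sigma> else None)"
  have "prefix_free_machine M" "M [] = Some \<sigma>"
    unfolding M_def by (rule constant_machine) simp
  then obtain q where "U q = Some \<sigma>"
    using assms unfolding universal_prefix_free_machine_def by blast
  then have "\<exists>p. U p = Some \<sigma> \<and> length p = length q" by blast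
  then have "\<exists>p. U p = Some \<sigma> \<and> length p = K U \<sigma>" unfolding K_def by (rule LeastI)
  then show thesis using that by blast
qed

text \<open>The easy half of the Levin-Schnorr theorem for a computable upper bound on the measure that depends only
  on the length of the string. The constant \<open>d\<close> is the level of the test that \<open>X\<close> avoids.\<close>

lemma random_complexity_lower_bound:
  assumes "universal_prefix_free_machine U" "cantor_measure \<mu>" "computable h"
    and "\<And>\<sigma>. measure \<mu> (cylinder \<sigma>) \<le> 1 / 2 ^ h (length \<sigma>)"
    and "martin_loef_random \<mu> X"
  shows "\<exists>d. \<forall>n. h n \<le> K U (initseg X n) + d"
proof -
  have U: "prefix_free_machine U" "partial_computable_str U"
    using assms(1) by (auto simp: universal_prefix_free_machine_def prefix_free_machine_def)
  have "martin_loef_test \<mu> (complexity_test U h)"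
    unfolding martin_loef_test_def
    using uniformly_Sigma1_complexity_test[OF U(2) assms(3)]
      measure_complexity_test_le[OF assms(2) U(1) assms(4)] by blast
  then obtain i where i: "X \<notin> complexity_test U h i"
    using assms(5) by (auto simp: martin_loef_random_def)
  have "h n \<le> K U (initseg X n) + i" for n
  proof (rule ccontr)
    assume "\<not> h n \<le> K U (initseg X n) + i"
    moreover obtain p where "U p = Some (initseg X n)" "length p = K U (initseg X n)"
      using assms(1) by (rule K_attained)
    ultimately have "X \<in> complexity_test U h i"
      unfolding complexity_test_def using mem_cylinder_initseg[of X n] by fastforce
    then show False using i by contradiction
  qed
  then show ?thesis by blast
qed

section \<open>The theorem\<close>

theorem theorem3p20:
  fixes \<mu> :: "(nat \<Rightarrow> bool) measure"
    and U :: "bool list \<Rightarrow> bool list option"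
  assumes "universal_prefix_free_machine U"
    and "cantor_measure \<mu>"
    and "continuous_measure \<mu>"
    and "computable_measure \<mu>"
  shows "\<exists>h :: nat \<Rightarrow> nat. computable h \<and> is_order h \<and>
     (\<exists>c::nat. \<forall>n. \<bar>int (h n) - int (order_inverse (granularity \<mu>) n)\<bar> \<le> int c) \<and>
     (\<forall>X. martin_loef_random \<mu> X \<longrightarrow> (\<exists>d::nat. \<forall>n. h n \<le> K U (initseg X n) + d))"
proof -
  let ?g = "order_inverse (granularity \<mu>)"
  obtain a b c where abc: "computable2 a" "computable2 b" "computable2 c"
    and approx: "\<forall>\<sigma> k. \<bar>measure \<mu> (cylinder \<sigma>) - (real (a (str_code \<sigma>) k) - real (b (str_code \<sigma>) k)) /
                     (real (c (str_code \<sigma>) k) + 1)\<bar> \<le> 1 / 2 ^ k"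
    using assms(4) unfolding computable_measure_def computable_real_fun_def by blast
  define q where "q s k = (real (a s k) - real (b s k)) / (real (c s k) + 1)" for s k
  have "\<bar>measure \<mu> (cylinder \<sigma>) - q (str_code \<sigma>) k\<bar> \<le> 1 / 2 ^ k" for \<sigma> k
    using approx by (simp only: q_def)
  note est = log_estimate_close[OF assms(2,3) this]
  have f: "computable (log_estimate q)"
    using abc q_def est(1) by (rule computable_log_estimate)
  define h where "h = running_max (log_estimate q)"
  have h: "computable h"
    unfolding h_def using f by (rule computable_running_max)
  have h_le: "h n \<le> ?g n + 1" and le_h: "?g n \<le> h n + 1" for n
    unfolding h_def
    using running_max_close[OF order_inverse_granularity_mono[OF assms(2,3)] order_inverse_0 est(2,3)]
    by blast+
  have "is_order h"
    unfolding h_def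
  proof (rule is_order_running_max)
    fix b
    obtain n where "b < ?g (Suc n)"
      using order_inverse_granularity_unbounded[OF assms(2,3)] by blast
    then have "b \<le> log_estimate q n" using est(3)[of n] by linarith
    then show "\<exists>n. b \<le> log_estimate q n" by blast
  qed
  moreover have "\<bar>int (h n) - int (?g n)\<bar> \<le> int 1" for n
    using h_le[of n] le_h[of n] by linarith
  moreover have "\<exists>d. \<forall>n. h n \<le> K U (initseg X n) + d" if "martin_loef_random \<mu> X" for X
  proof -
    \<comment> \<open>Strings of length \<open>n\<close> have measure at most \<open>1 / 2 ^ (?g n - 1)\<close>, and \<open>h\<close> may exceed \<open>?g\<close> by 1, so
      lowering \<open>h\<close> by 2 makes it a valid exponent.\<close>
    have "computable (\<lambda>n. h n - 2)"
      unfolding computable_iff_recursive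
      by (intro recursive_intros recursive_computable[OF h]; simp)
    moreover have "measure \<mu> (cylinder \<sigma>) \<le> 1 / 2 ^ (h (length \<sigma>) - 2)" for \<sigma>
    proof -
      have "(2::real) ^ (h (length \<sigma>) - 2) \<le> 2 ^ (?g (length \<sigma>) - 1)"
        using h_le[of "length \<sigma>"] by (intro power_increasing) auto
      then have "1 / 2 ^ (?g (length \<sigma>) - 1) \<le> 1 / (2::real) ^ (h (length \<sigma>) - 2)"
        by (intro divide_left_mono) auto
      with measure_cylinder_le_order_inverse[OF assms(2,3)] show ?thesis by (rule order_trans)
    qed
    ultimately have "\<exists>d. \<forall>n. h n - 2 \<le> K U (initseg X n) + d"
      using that by (rule random_complexity_lower_bound[OF assms(1,2)])
    then obtain d where "\<And>n. h n - 2 \<le> K U (initseg X n) + d" by blast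
    then have "h n \<le> K U (initseg X n) + (d + 2)" for n
      by (metis add.assoc le_diff_conv)
    then show ?thesis by blast
  qed
  ultimately show ?thesis using h by blast
qed

end
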